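(* Let $n,d\ge 1$ and let $\mathcal{M}$ be a quadratic module in $\mathcal{M}_n(\mathbb{R}[X])$. Then the following are equivalent: (1) $\mathcal{M}$ is Archimedean. (2) $r\cdot\mathbf{I}_n-\sum_{i=1}^d x_i^2\cdot\mathbf{I}_n\in\mathcal{M}$ for some positive real number $r$. (3) There is a positive real number $r$ such that $r\cdot\mathbf{I}_n\pm x_i\cdot\mathbf{I}_n\in\mathcal{M}$ for every $i=1,\dots,d$.
   Context: $\mathbb{R}[X]=\mathbb{R}[x_1,\dots,x_d]$. $\mathcal{M}_n(\mathbb{R}[X])$ is the ring of $n\times n$ matrices over $\mathbb{R}[X]$, $\mathcal{S}_n(\mathbb{R}[X])$ its subset of symmetric matrices, $\mathbf{I}_n$ the identity matrix. A quadratic module in $\mathcal{M}_n(\mathbb{R}[X])$ is a set $\mathcal{M}\subseteq\mathcal{S}_n(\mathbb{R}[X])$ with $\mathbf{I}_n\in\mathcal{M}$, $\mathcal{M}+\mathcal{M}\subseteq\mathcal{M}$, and $A^T\mathcal{M}A\subseteq\mathcal{M}$ for all $A\in\mathcal{M}_n(\mathbb{R}[X])$. It is called Archimedean if for each $\mathbf{A}\in\mathcal{M}_n(\mathbb{R}[X])$ there is a number $k\in\mathbb{N}$ such that $k\cdot\mathbf{I}_n-\mathbf{A}^T\mathbf{A}\in\mathcal{M}$. *)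

theory Defs
  imports "HOL-Analysis.Finite_Cartesian_Product" "HOL-Library.Poly_Mapping"
begin

text \<open>
  Real polynomials in the variables indexed by the finite type \<open>'d\<close>: finitely supported
  coefficient functions on the monomials, a monomial being an exponent vector
  \<open>'d \<Rightarrow>\<^sub>0 nat\<close>.  The library's multiplication on \<^type>\<open>poly_mapping\<close> is convolution.
\<close>

type_synonym 'd mpoly = "('d \<Rightarrow>\<^sub>0 nat) \<Rightarrow>\<^sub>0 real"

definition Const :: "real \<Rightarrow> 'd mpoly" where
  "Const c = Poly_Mapping.single 0 c"

definition Var :: "'d \<Rightarrow> 'd mpoly" where
  "Var i = Poly_Mapping.single (Poly_Mapping.single i 1) 1"

definition symmetric_matrices :: "('d::finite mpoly ^ 'n::finite ^ 'n) set" where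
  "symmetric_matrices = {A. transpose A = A}"

definition quadratic_module :: "('d::finite mpoly ^ 'n::finite ^ 'n) set \<Rightarrow> bool" where
  "quadratic_module M \<longleftrightarrow>
     M \<subseteq> symmetric_matrices \<and>
     mat 1 \<in> M \<and>
     (\<forall>A\<in>M. \<forall>B\<in>M. A + B \<in> M) \<and>
     (\<forall>A :: 'd mpoly ^ 'n ^ 'n. \<forall>B\<in>M. transpose A ** B ** A \<in> M)"

text \<open>Scalar multiples of the identity are written \<open>mat p\<close>, the diagonal matrix with
  all diagonal entries equal to \<open>p\<close>.\<close>

definition archimedean :: "('d::finite mpoly ^ 'n::finite ^ 'n) set \<Rightarrow> bool" where
  "archimedean M \<longleftrightarrow>
     (\<forall>A :: 'd mpoly ^ 'n ^ 'n. \<exists>k::nat. mat (of_nat k) - transpose A ** A \<in> M)"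

end

theory Submission
  imports Defs
begin

text \<open>
  Call \<open>A\<close> bounded if \<open>r - A\<^sup>T A \<in> M\<close> for some real \<open>r \<ge> 0\<close>; \<open>M\<close> is Archimedean iff every matrix
  is bounded.  The bounded matrices form a subring, by the identities
  \<open>(A + B)\<^sup>T (A + B) + (A - B)\<^sup>T (A - B) = 2 A\<^sup>T A + 2 B\<^sup>T B\<close> and
  \<open>r s - (A B)\<^sup>T (A B) = B\<^sup>T (r - A\<^sup>T A) B + r (s - B\<^sup>T B)\<close>.  It contains the constants and the matrix
  units, so it is everything as soon as it contains the variables.  Condition (2) gives
  \<open>r - x\<^sub>i\<^sup>2 \<in> M\<close> by adding the other squares, and condition (3) gives it via
  \<open>2 r (r\<^sup>2 - x\<^sup>2) = (r + x) (r - x) (r + x) + (r - x) (r + x) (r - x)\<close>.  Conversely,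
  \<open>r + 1/4 \<plusminus> x = (r - x\<^sup>2) + (x \<plusminus> 1/2)\<^sup>2\<close>.
\<close>

section \<open>Matrix arithmetic\<close>

lemma matrix_add_rdistrib':
  fixes A B :: "'a::semiring_1 ^ 'n ^ 'm"
  shows "(A + B) ** C = A ** C + B ** C"
  by (vector matrix_matrix_mult_def sum.distrib[symmetric] distrib_right)

lemma matrix_diff_ldistrib:
  fixes A :: "'a::ring_1 ^ 'n ^ 'm"
  shows "A ** (B - C) = A ** B - A ** C"
  by (vector matrix_matrix_mult_def sum_subtractf[symmetric] right_diff_distrib)

lemma matrix_diff_rdistrib:
  fixes A B :: "'a::ring_1 ^ 'n ^ 'm"
  shows "(A - B) ** C = A ** C - B ** C"
  by (vector matrix_matrix_mult_def sum_subtractf[symmetric] left_diff_distrib)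

lemma transpose_add: "transpose (A + B) = transpose A + transpose B"
  by (vector transpose_def)

lemma transpose_diff: "transpose (A - B) = transpose A - transpose B"
  by (vector transpose_def)

lemma mat_add: "mat (p + q) = mat p + (mat q :: 'a::monoid_add ^ 'n ^ 'n)"
  by (simp add: vec_eq_iff mat_def)

lemma mat_diff: "mat (p - q) = mat p - (mat q :: 'a::group_add ^ 'n ^ 'n)"
  by (simp add: vec_eq_iff mat_def)

lemma mat_sum: "mat (\<Sum>i\<in>I. f i) = (\<Sum>i\<in>I. mat (f i) :: 'a::comm_monoid_add ^ 'n ^ 'n)"
  by (induction I rule: infinite_finite_induct) (simp_all add: mat_add)

lemma mat_mult_component: "(mat p ** A) $ i $ j = p * A $ i $ j"
  by (simp add: matrix_matrix_mult_def mat_def if_distrib if_distribR cong: if_cong)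

lemma mat_mult: "mat (p * q) = mat p ** mat q"
  by (simp add: vec_eq_iff mat_mult_component) (simp add: mat_def)

lemma mat_commute:
  fixes A :: "'a::comm_semiring_1 ^ 'n ^ 'n"
  shows "A ** mat p = mat p ** A"
  by (simp add: vec_eq_iff mat_mult_component)
    (simp add: matrix_matrix_mult_def mat_def if_distrib if_distribR mult.commute cong: if_cong)

section \<open>Matrix units\<close>

definition matrix_unit :: "'n \<Rightarrow> 'n \<Rightarrow> 'a::semiring_1 ^ 'n ^ 'n" where
  "matrix_unit i j = (\<chi> a b. if a = i \<and> b = j then 1 else 0)"

lemma matrix_unit_mult:
  "matrix_unit i j ** matrix_unit k l =
     (if j = k then matrix_unit i l else (0 :: 'a::semiring_1 ^ 'n ^ 'n))"
proof -
  \<comment> \<open>Recast as a conditional on \<open>c = j\<close>, so that the sum over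
    \<open>c\<close> collapses to a single term.\<close>
  have "(\<Sum>c\<in>UNIV. (if a = i \<and> c = j then 1 else 0) * (if c = k \<and> b = l then 1 else 0 :: 'a)) =
        (\<Sum>c\<in>UNIV. if c = j then (if a = i \<and> j = k \<and> b = l then 1 else 0) else 0)" for a b
    by (rule sum.cong) auto
  then show ?thesis
    by (simp add: vec_eq_iff matrix_matrix_mult_def matrix_unit_def)
qed

lemma transpose_matrix_unit: "transpose (matrix_unit i j) = matrix_unit j i"
  by (auto simp: vec_eq_iff transpose_def matrix_unit_def)

text \<open>Shows that scalar matrices and matrix units generate the matrix ring.\<close>

lemma matrix_unit_expansion:
  fixes A :: "'a::semiring_1 ^ 'n ^ 'n"
  shows "A = (\<Sum>i\<in>UNIV. \<Sum>j\<in>UNIV. mat (A $ i $ j) ** matrix_unit i j)"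
proof -
  have "(\<Sum>i\<in>UNIV. \<Sum>j\<in>UNIV. A $ i $ j * (if a = i \<and> b = j then 1 else 0)) =
        (\<Sum>i\<in>UNIV. if i = a then (\<Sum>j\<in>UNIV. if j = b then A $ a $ b else 0) else 0)" for a b
    by (rule sum.cong) (auto simp: if_distrib cong: if_cong)
  then show ?thesis
    by (simp add: vec_eq_iff mat_mult_component) (simp add: matrix_unit_def)
qed

section \<open>Polynomials\<close>

lemma Const_0: "Const 0 = 0"
  by (simp add: Const_def)

lemma Const_1: "Const 1 = 1"
  by (simp add: Const_def)

lemma Const_add: "Const (a + b) = Const a + Const b"
  by (simp add: Const_def single_add)

lemma Const_diff: "Const (a - b) = Const a - Const b"
  by (simp add: Const_def single_diff)

lemma Const_mult: "Const (a * b) = Const a * Const b"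
  by (simp add: Const_def mult_single)

lemma Const_of_nat: "Const (of_nat k) = of_nat k"
  by (simp add: Const_def)

text \<open>Serves on two levels: for polynomials it splits off a term, for exponent vectors a power
  of one variable.\<close>

lemma poly_mapping_single_induct [case_names zero plus]:
  fixes f :: "'k \<Rightarrow>\<^sub>0 'v::monoid_add"
  assumes "P 0" and "\<And>k c f. P f \<Longrightarrow> P (Poly_Mapping.single k c + f)"
  shows "P f"
proof (induction f rule: update_induct)
  case const
  show ?case by (fact assms(1))
next
  case (update f k c)
  \<comment> \<open>Since \<open>k\<close> lies outside the support of \<open>f\<close>, overwriting
    the value there amounts to adding it.\<close>
  have "Poly_Mapping.update k c f = Poly_Mapping.single k c + f"
    using update.hyps
    by (auto intro!: poly_mapping_eqI
        simp: lookup_update lookup_add lookup_single not_in_keys_iff_lookup_eq_zero)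
  then show ?case using assms(2) update.IH by simp
qed

text \<open>Constants and variables generate the polynomial ring: addition of exponents is
  multiplication of monomials, so every monomial is a product of powers of variables.\<close>

lemma mpoly_ring_induct [case_names Const Var add mult]:
  fixes p :: "'d mpoly"
  assumes Const: "\<And>c. P (Const c)" and Var: "\<And>i. P (Var i)"
    and add: "\<And>p q. P p \<Longrightarrow> P q \<Longrightarrow> P (p + q)"
    and mult: "\<And>p q. P p \<Longrightarrow> P q \<Longrightarrow> P (p * q)"
  shows "P p"
proof (induction p rule: poly_mapping_single_induct)
  case zero
  show ?case using Const[of 0] by (simp add: Const_0)
next
  case (plus m c f)
  have power: "P (Poly_Mapping.single (Poly_Mapping.single i k) 1)" for i k
  proof (induction k)
    case 0
    show ?case using Const[of 1] by (simp add: Const_1)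
  next
    case (Suc k)
    have "Poly_Mapping.single (Poly_Mapping.single i (Suc k)) 1 =
          Var i * Poly_Mapping.single (Poly_Mapping.single i k) 1"
      by (simp add: Var_def mult_single single_add[symmetric])
    then show ?case using mult[OF Var Suc.IH] by simp
  qed
  have "P (Poly_Mapping.single m 1)"
  proof (induction m rule: poly_mapping_single_induct)
    case zero
    show ?case using Const[of 1] by (simp add: Const_1)
  next
    case (plus i k m)
    then show ?case using mult[OF power[of i k] plus.IH] by (simp add: mult_single)
  qed
  from mult[OF Const[of c] this] have "P (Poly_Mapping.single m c)"
    by (simp add: Const_def mult_single)
  then show ?case using add plus.IH by blast
qed

section \<open>Bounded matrices\<close>

lemma quadratic_module_add:
  assumes "quadratic_module M" "A \<in> M" "B \<in> M"
  shows "A + B \<in> M"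
  using assms unfolding quadratic_module_def by blast

lemma quadratic_module_congruence:
  assumes "quadratic_module M" "B \<in> M"
  shows "transpose A ** B ** A \<in> M"
  using assms unfolding quadratic_module_def by blast

lemma quadratic_module_square:
  fixes A :: "'d::finite mpoly ^ 'n::finite ^ 'n"
  assumes "quadratic_module M"
  shows "transpose A ** A \<in> M"
proof -
  have "mat 1 \<in> M" using assms unfolding quadratic_module_def by blast
  from quadratic_module_congruence[OF assms this, of A] show ?thesis by simp
qed

text \<open>This is congruence by the scalar matrix \<open>mat p\<close>, which is symmetric and
  central.\<close>

lemma quadratic_module_mat_square_mult:
  assumes "quadratic_module M" "A \<in> M"
  shows "mat (p\<^sup>2) ** A \<in> M"
  using quadratic_module_congruence[OF assms, of "mat p"]
  by (simp add: power2_eq_square mat_mult mat_commute[of "mat p ** A" p] matrix_mul_assoc)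

lemma quadratic_module_mat_square:
  assumes "quadratic_module M"
  shows "mat (p\<^sup>2) \<in> M"
  using quadratic_module_square[OF assms, of "mat p"]
  by (simp add: power2_eq_square mat_mult)

text \<open>A nonnegative constant is the square of the polynomial
  \<open>Const (sqrt c)\<close>.\<close>

lemma quadratic_module_Const_mult:
  assumes "quadratic_module M" "A \<in> M" "c \<ge> 0"
  shows "mat (Const c) ** A \<in> M"
  using quadratic_module_mat_square_mult[OF assms(1,2), of "Const (sqrt c)"] \<open>c \<ge> 0\<close>
  by (simp add: power2_eq_square Const_mult[symmetric])

lemma quadratic_module_Const:
  assumes "quadratic_module M" "c \<ge> 0"
  shows "mat (Const c) \<in> M"
  using quadratic_module_mat_square[OF assms(1), of "Const (sqrt c)"] \<open>c \<ge> 0\<close>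
  by (simp add: power2_eq_square Const_mult[symmetric])

lemma quadratic_module_sum:
  assumes "quadratic_module M" "\<And>i. i \<in> I \<Longrightarrow> f i \<in> M"
  shows "sum f I \<in> M"
  using assms(2)
proof (induction I rule: infinite_finite_induct)
  case (insert i I)
  then show ?case by (simp add: quadratic_module_add[OF assms(1)])
\<comment> \<open>The empty sum and, by default, a sum over an infinite set are 0, a nonnegative
  constant.\<close>
qed (use quadratic_module_Const[OF assms(1), of 0] in \<open>simp_all add: Const_0\<close>)

lemma quadratic_module_Const_mono:
  assumes "quadratic_module M" "mat (Const r) - A \<in> M" "r \<le> s"
  shows "mat (Const s) - A \<in> M"
proof -
  have "mat (Const s) - A = mat (Const (s - r)) + (mat (Const r) - A)"
    by (simp add: Const_diff mat_diff)
  also have "\<dots> \<in> M"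
    using assms by (intro quadratic_module_add quadratic_module_Const) simp_all
  finally show ?thesis .
qed

section \<open>Bounded matrices and their closure under the ring operations\<close>

definition bounded_matrix :: "('d::finite mpoly ^ 'n::finite ^ 'n) set \<Rightarrow> 'd mpoly ^ 'n ^ 'n \<Rightarrow> bool"
  where "bounded_matrix M A \<longleftrightarrow> (\<exists>r\<ge>0. mat (Const r) - transpose A ** A \<in> M)"

lemma bounded_matrix_mat_iff:
  "bounded_matrix M (mat p) \<longleftrightarrow> (\<exists>r\<ge>0. mat (Const r) - mat (p\<^sup>2) \<in> M)"
  by (simp add: bounded_matrix_def power2_eq_square mat_mult)

text \<open>Rounding a real bound up to a natural number only adds a nonnegative constant.\<close>

lemma archimedean_iff_bounded:
  fixes M :: "('d::finite mpoly ^ 'n::finite ^ 'n) set"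
  assumes "quadratic_module M"
  shows "archimedean M \<longleftrightarrow> (\<forall>A. bounded_matrix M A)"
proof
  assume "archimedean M"
  then show "\<forall>A. bounded_matrix M A"
    unfolding archimedean_def bounded_matrix_def by (metis Const_of_nat of_nat_0_le_iff)
next
  assume *: "\<forall>A. bounded_matrix M A"
  show "archimedean M"
    unfolding archimedean_def
  proof
    fix A :: "'d mpoly ^ 'n ^ 'n"
    obtain r where "mat (Const r) - transpose A ** A \<in> M"
      using * unfolding bounded_matrix_def by blast
    moreover obtain k :: nat where "r \<le> k" using real_arch_simple by blast
    ultimately show "\<exists>k. mat (of_nat k) - transpose A ** A \<in> M"
      using quadratic_module_Const_mono[OF assms] by (metis Const_of_nat)
  qed
qed

lemma bounded_matrix_add:
  assumes M: "quadratic_module M" and "bounded_matrix M A" "bounded_matrix M B"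
  shows "bounded_matrix M (A + B)"
proof -
  obtain r s where r: "r \<ge> 0" "mat (Const r) - transpose A ** A \<in> M"
    and s: "s \<ge> 0" "mat (Const s) - transpose B ** B \<in> M"
    using assms unfolding bounded_matrix_def by blast
  \<comment> \<open>Parallelogram law: the square of \<open>A - B\<close> cancels the cross terms,
    at the price of using each bound twice.\<close>
  have "mat (Const (r + r + s + s)) - transpose (A + B) ** (A + B) =
      (mat (Const r) - transpose A ** A) + (mat (Const r) - transpose A ** A) +
      (mat (Const s) - transpose B ** B) + (mat (Const s) - transpose B ** B) +
      transpose (A - B) ** (A - B)"
    \<comment> \<open>Once all products are expanded, only an additive identity with matrix products
      as atoms remains.\<close>
    by (simp only: Const_add mat_add transpose_add transpose_diff matrix_add_ldistrib
        matrix_add_rdistrib' matrix_diff_ldistrib matrix_diff_rdistrib) (simp add: algebra_simps)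
  also have "\<dots> \<in> M"
    by (intro quadratic_module_add quadratic_module_square M r s)
  finally show ?thesis
    unfolding bounded_matrix_def using r(1) s(1) by (metis add_nonneg_nonneg)
qed

lemma bounded_matrix_mult:
  assumes M: "quadratic_module M" and "bounded_matrix M A" "bounded_matrix M B"
  shows "bounded_matrix M (A ** B)"
proof -
  obtain r s where r: "r \<ge> 0" "mat (Const r) - transpose A ** A \<in> M"
    and s: "s \<ge> 0" "mat (Const s) - transpose B ** B \<in> M"
    using assms unfolding bounded_matrix_def by blast
  \<comment> \<open>Subtract and add \<open>r\<close> times \<open>transpose B ** B\<close>: the
    first summand is a congruence by \<open>B\<close>, the second a multiple by
    \<open>r \<ge> 0\<close>.\<close>
  have "mat (Const (r * s)) - transpose (A ** B) ** (A ** B) =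
      transpose B ** (mat (Const r) - transpose A ** A) ** B +
      mat (Const r) ** (mat (Const s) - transpose B ** B)"
    by (simp add: Const_mult mat_mult matrix_transpose_mul matrix_diff_ldistrib
        matrix_diff_rdistrib matrix_mul_assoc mat_commute[of "transpose B"])
  also have "\<dots> \<in> M"
    by (intro quadratic_module_add quadratic_module_congruence quadratic_module_Const_mult M r s)
  finally show ?thesis
    unfolding bounded_matrix_def using r(1) s(1) by (metis mult_nonneg_nonneg)
qed

lemma bounded_matrix_Const:
  assumes "quadratic_module M"
  shows "bounded_matrix M (mat (Const c))"
  unfolding bounded_matrix_mat_iff
proof (intro exI conjI)
  show "mat (Const (c\<^sup>2)) - mat ((Const c)\<^sup>2) \<in> M"
    using quadratic_module_Const[OF assms, of 0]
    by (simp add: power2_eq_square Const_mult Const_0)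
qed simp

lemma bounded_matrix_sum:
  assumes "quadratic_module M" "\<And>i. i \<in> I \<Longrightarrow> bounded_matrix M (f i)"
  shows "bounded_matrix M (sum f I)"
  using assms(2)
proof (induction I rule: infinite_finite_induct)
  case (insert i I)
  then show ?case by (simp add: bounded_matrix_add[OF assms(1)])
qed (use bounded_matrix_Const[OF assms(1), of 0] in \<open>simp_all add: Const_0\<close>)

text \<open>The product \<open>transpose (matrix_unit i j) ** matrix_unit i j\<close> is the
  symmetric idempotent \<open>matrix_unit j j\<close>. Its complement \<open>?F\<close> is again
  one, hence equal to its own square, so the bound 1 works.\<close>

lemma bounded_matrix_unit:
  assumes "quadratic_module M"
  shows "bounded_matrix M (matrix_unit i j)"
proof -
  let ?F = "mat 1 - matrix_unit j j"
  have "mat (Const 1) - transpose (matrix_unit i j) ** matrix_unit i j = transpose ?F ** ?F"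
    by (simp add: Const_1 transpose_diff transpose_matrix_unit matrix_unit_mult
        matrix_diff_ldistrib matrix_diff_rdistrib)
  also have "\<dots> \<in> M" by (rule quadratic_module_square[OF assms])
  finally show ?thesis unfolding bounded_matrix_def by (metis zero_le_one)
qed

text \<open>Boundedness spreads in two stages: from variables to all scalar matrices, then through
  matrix units to all matrices.\<close>

lemma archimedean_if_bounded_Var:
  fixes M :: "('d::finite mpoly ^ 'n::finite ^ 'n) set"
  assumes M: "quadratic_module M" and Var: "\<And>i. bounded_matrix M (mat (Var i))"
  shows "archimedean M"
proof -
  have "bounded_matrix M (mat p)" for p
    by (induction p rule: mpoly_ring_induct)
      (simp_all add: M Var bounded_matrix_Const bounded_matrix_add bounded_matrix_mult
        mat_add mat_mult)
  then have "bounded_matrix M A" for A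
    by (subst matrix_unit_expansion[of A])
      (intro bounded_matrix_sum bounded_matrix_mult bounded_matrix_unit M)
  then show ?thesis using archimedean_iff_bounded[OF M] by blast
qed

section \<open>Bounds on the variables from conditions (2) and (3), and back\<close>

lemma bounded_Var_if_sum_squares:
  fixes M :: "('d::finite mpoly ^ 'n::finite ^ 'n) set"
  assumes M: "quadratic_module M" and "r > 0"
    and sum: "mat (Const r) - (\<Sum>i\<in>UNIV. mat ((Var i)\<^sup>2)) \<in> M"
  shows "bounded_matrix M (mat (Var i))"
proof -
  have remove: "(\<Sum>i\<in>UNIV. mat ((Var i)\<^sup>2) :: 'd mpoly ^ 'n ^ 'n) =
      mat ((Var i)\<^sup>2) + (\<Sum>j\<in>UNIV - {i}. mat ((Var j)\<^sup>2))"
    by (rule sum.remove) simp_all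
  have "(mat (Const r) - mat ((Var i)\<^sup>2) :: 'd mpoly ^ 'n ^ 'n) =
      (mat (Const r) - (\<Sum>i\<in>UNIV. mat ((Var i)\<^sup>2))) + (\<Sum>j\<in>UNIV - {i}. mat ((Var j)\<^sup>2))"
    unfolding remove by (simp only: diff_diff_eq[symmetric] diff_add_cancel)
  also have "\<dots> \<in> M"
    by (intro quadratic_module_add quadratic_module_sum quadratic_module_mat_square M sum)
  finally show ?thesis unfolding bounded_matrix_mat_iff using \<open>r > 0\<close> by (meson less_imp_le)
qed

lemma bounded_mat_if_two_sided:
  assumes M: "quadratic_module M" and "r > 0"
    and plus: "mat (Const r) + mat p \<in> M" and minus: "mat (Const r) - mat p \<in> M"
  shows "bounded_matrix M (mat p)"
proof -
  \<comment> \<open>\<open>?h\<close> inverts the factor \<open>2 * r\<close> that arises from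
    \<open>(?c + p) + (?c - p)\<close> below.\<close>
  let ?c = "Const r" and ?h = "Const (1 / (2 * r))"
  have "?h * (?c + ?c) = Const (1 / (2 * r) * (r + r))"
    by (simp only: Const_mult Const_add)
  also have "\<dots> = 1" using \<open>r > 0\<close> by (simp add: Const_1 mult_2[symmetric])
  finally have unit: "?h * (?c + ?c) = 1" .
  have "Const (r\<^sup>2) - p\<^sup>2 = (?h * (?c + ?c)) * (?c * ?c - p * p)"
    unfolding unit by (simp add: power2_eq_square Const_mult)
  \<comment> \<open>Both summands contain \<open>(?c + p) * (?c - p)\<close>; each is a square times
    one of the two given elements.\<close>
  also have "\<dots> = ?h * ((?c + p)\<^sup>2 * (?c - p) + (?c - p)\<^sup>2 * (?c + p))"
    by (simp add: power2_eq_square algebra_simps)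
  finally have "mat (Const (r\<^sup>2)) - mat (p\<^sup>2) =
      mat ?h ** (mat ((?c + p)\<^sup>2) ** (mat ?c - mat p) + mat ((?c - p)\<^sup>2) ** (mat ?c + mat p))"
    by (simp only: mat_add[symmetric] mat_diff[symmetric] mat_mult[symmetric])
  also have "\<dots> \<in> M"
    using \<open>r > 0\<close> by (intro quadratic_module_Const_mult quadratic_module_add
        quadratic_module_mat_square_mult M plus minus) simp
  finally show ?thesis unfolding bounded_matrix_mat_iff by (meson zero_le_power2)
qed

text \<open>Completing the square: the square of \<open>p\<close> plus or minus \<open>1/2\<close>
  has cross term plus or minus \<open>p\<close> and constant term \<open>1/4\<close>.\<close>

lemma two_sided_if_square_le:
  assumes M: "quadratic_module M" and r: "mat (Const r) - mat (p\<^sup>2) \<in> M"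
  shows "mat (Const (r + 1 / 4)) + mat p \<in> M" "mat (Const (r + 1 / 4)) - mat p \<in> M"
proof -
  have quarter: "Const (1 / 4) = Const (1 / 2) * Const (1 / 2)"
    by (simp add: Const_mult[symmetric])
  have half: "Const (1 / 2) * p + Const (1 / 2) * p = p"
    by (simp add: distrib_right[symmetric] Const_add[symmetric] Const_1)
  have "Const (r + 1 / 4) + p = (Const r - p\<^sup>2) + (p + Const (1 / 2))\<^sup>2"
    using half by (simp add: Const_add quarter power2_eq_square algebra_simps)
  then have "mat (Const (r + 1 / 4)) + mat p =
      (mat (Const r) - mat (p\<^sup>2)) + mat ((p + Const (1 / 2))\<^sup>2)"
    by (simp only: mat_add[symmetric] mat_diff[symmetric])
  also have "\<dots> \<in> M" by (intro quadratic_module_add quadratic_module_mat_square M r)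
  finally show "mat (Const (r + 1 / 4)) + mat p \<in> M" .
  have "Const (r + 1 / 4) - p = (Const r - p\<^sup>2) + (p - Const (1 / 2))\<^sup>2"
    using half by (simp add: Const_add quarter power2_eq_square algebra_simps)
  then have "mat (Const (r + 1 / 4)) - mat p =
      (mat (Const r) - mat (p\<^sup>2)) + mat ((p - Const (1 / 2))\<^sup>2)"
    by (simp only: mat_add[symmetric] mat_diff[symmetric])
  also have "\<dots> \<in> M" by (intro quadratic_module_add quadratic_module_mat_square M r)
  finally show "mat (Const (r + 1 / 4)) - mat p \<in> M" .
qed

lemma archimedean_imp_sum_squares:
  fixes M :: "('d::finite mpoly ^ 'n::finite ^ 'n) set"
  assumes M: "quadratic_module M" and arch: "archimedean M"
  shows "\<exists>r>0. mat (Const r) - (\<Sum>i\<in>UNIV. mat ((Var i)\<^sup>2)) \<in> M"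
proof -
  have "\<exists>r\<ge>0. mat (Const r) - mat ((Var i)\<^sup>2) \<in> M" for i
    using arch archimedean_iff_bounded[OF M] bounded_matrix_mat_iff by blast
  then obtain r where r: "\<And>i. r i \<ge> 0" "\<And>i. mat (Const (r i)) - mat ((Var i)\<^sup>2) \<in> M"
    by metis
  have "Const (\<Sum>i\<in>I. r i) = (\<Sum>i\<in>I. Const (r i) :: 'd mpoly)" for I
    by (induction I rule: infinite_finite_induct) (simp_all add: Const_0 Const_add)
  then have "mat (Const (\<Sum>i\<in>UNIV. r i)) - (\<Sum>i\<in>UNIV. mat ((Var i)\<^sup>2)) =
      (\<Sum>i\<in>UNIV. mat (Const (r i)) - mat ((Var i)\<^sup>2) :: 'd mpoly ^ 'n ^ 'n)"
    by (simp add: mat_sum sum_subtractf)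
  also have "\<dots> \<in> M" by (intro quadratic_module_sum M r)
  \<comment> \<open>The extra 1 makes the bound strictly positive even if every \<open>r i\<close>
    is 0.\<close>
  finally have "mat (Const ((\<Sum>i\<in>UNIV. r i) + 1)) - (\<Sum>i\<in>UNIV. mat ((Var i)\<^sup>2)) \<in> M"
    by (rule quadratic_module_Const_mono[OF M]) simp
  moreover have "(\<Sum>i\<in>UNIV. r i) + 1 > 0" using sum_nonneg[of UNIV r] r(1) by simp
  ultimately show ?thesis by blast
qed

theorem proposition5p3:
  fixes M :: "('d::finite mpoly ^ 'n::finite ^ 'n) set"
  assumes "quadratic_module M"
  shows "(archimedean M \<longleftrightarrow>
            (\<exists>r>0. mat (Const r) - (\<Sum>i\<in>UNIV. mat ((Var i)\<^sup>2)) \<in> M))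
       \<and> (archimedean M \<longleftrightarrow>
            (\<exists>r>0. \<forall>i. mat (Const r) + mat (Var i) \<in> M \<and>
                        mat (Const r) - mat (Var i) \<in> M))"
proof (intro conjI iffI)
  assume "archimedean M"
  then show sum: "\<exists>r>0. mat (Const r) - (\<Sum>i\<in>UNIV. mat ((Var i)\<^sup>2)) \<in> M"
    by (rule archimedean_imp_sum_squares[OF assms])
next
  assume "\<exists>r>0. mat (Const r) - (\<Sum>i\<in>UNIV. mat ((Var i)\<^sup>2)) \<in> M"
  then show "archimedean M"
    using archimedean_if_bounded_Var[OF assms] bounded_Var_if_sum_squares[OF assms] by blast
next
  assume "archimedean M"
  then have "\<exists>r\<ge>0. mat (Const r) - mat ((Var i)\<^sup>2) \<in> M" for i
    using archimedean_iff_bounded[OF assms] bounded_matrix_mat_iff by blast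
  then obtain r where r: "\<And>i. r i \<ge> 0" "\<And>i. mat (Const (r i)) - mat ((Var i)\<^sup>2) \<in> M"
    by metis
  \<comment> \<open>The sum of the nonnegative bounds dominates each of them and so serves all
    variables at once.\<close>
  have "mat (Const (\<Sum>i\<in>UNIV. r i)) - mat ((Var i)\<^sup>2) \<in> M" for i
    by (rule quadratic_module_Const_mono[OF assms r(2)]) (simp add: member_le_sum r(1))
  moreover have "(\<Sum>i\<in>UNIV. r i) + 1 / 4 > 0"
    using sum_nonneg[of UNIV r] r(1) by (simp add: add_nonneg_pos)
  ultimately show "\<exists>r>0. \<forall>i. mat (Const r) + mat (Var i) \<in> M \<and>
      mat (Const r) - mat (Var i) \<in> M"
    using two_sided_if_square_le[OF assms] by blast
next
  assume "\<exists>r>0. \<forall>i. mat (Const r) + mat (Var i) \<in> M \<and> mat (Const r) - mat (Var i) \<in> M"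
  then show "archimedean M"
    using archimedean_if_bounded_Var[OF assms] bounded_mat_if_two_sided[OF assms] by blast
qed

end
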